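(* For $n\ge 1$ let $G_n$ be the graph with vertex set $V=\{x\in\{-1,1\}^{2n}:\sum_i x_i=0\}$, where $x\sim y$ iff $\mathrm{supp}(x-y)$ consists of two consecutive indices $\{i,i+1\}$ (equivalently, $y$ is obtained from $x$ by transposing adjacent unequal entries $x_i\ne x_{i+1}$). Then $\mathrm{Ric}(G_n)\ge -1$ for every $n$, and $\lim_{n\to\infty}\mathrm{Ric}(G_n)=-1$.
   Context: For a graph $G=(V,E)$ (undirected, simple, locally finite, no isolated vertices; $y\sim x$ means adjacency) and $f,g:V\to\mathbb R$ define $\Delta f(x)=\sum_{y\sim x}(f(y)-f(x))$, $\Gamma(f,g)(x)=\frac12\sum_{y\sim x}(f(x)-f(y))(g(x)-g(y))$, $\Gamma(f)=\Gamma(f,f)$, $\Gamma_2(f)=\frac12\Delta\Gamma(f)-\Gamma(f,\Delta f)$. The curvature $\mathrm{Ric}(G)$ is the largest $K\in\mathbb R$ such that $\Gamma_2(f)(x)\ge K\,\Gamma(f)(x)$ for all $f:V\to\mathbb R$ and all $x\in V$. *)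

theory Defs
  imports "HOL-Analysis.Analysis"
begin

locale lf_graph =
  fixes V :: "'a set" and adj :: "'a \<Rightarrow> 'a \<Rightarrow> bool"
  assumes adj_in_verts: "adj x y \<Longrightarrow> x \<in> V \<and> y \<in> V"
    and adj_sym: "adj x y \<Longrightarrow> adj y x"
    and adj_irrefl: "\<not> adj x x"
    and locally_finite: "x \<in> V \<Longrightarrow> finite {y. adj x y}"
    and no_isolated: "x \<in> V \<Longrightarrow> \<exists>y. adj x y"

definition laplacian :: "('a \<Rightarrow> 'a \<Rightarrow> bool) \<Rightarrow> ('a \<Rightarrow> real) \<Rightarrow> 'a \<Rightarrow> real" where
  "laplacian adj f x = (\<Sum>y | adj x y. f y - f x)"

definition carre :: "('a \<Rightarrow> 'a \<Rightarrow> bool) \<Rightarrow> ('a \<Rightarrow> real) \<Rightarrow> ('a \<Rightarrow> real) \<Rightarrow> 'a \<Rightarrow> real" where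
  "carre adj f g x = 1 / 2 * (\<Sum>y | adj x y. (f x - f y) * (g x - g y))"

definition carre2 :: "('a \<Rightarrow> 'a \<Rightarrow> bool) \<Rightarrow> ('a \<Rightarrow> real) \<Rightarrow> 'a \<Rightarrow> real" where
  "carre2 adj f x = 1 / 2 * laplacian adj (carre adj f f) x - carre adj f (laplacian adj f) x"

text \<open>
  Test functions range over the whole type instead of \<open>V\<close>; since all neighbours of
  vertices lie in \<open>V\<close>, only their values on \<open>V\<close> matter.
\<close>

definition Ric :: "'a set \<Rightarrow> ('a \<Rightarrow> 'a \<Rightarrow> bool) \<Rightarrow> real" where
  "Ric V adj = (GREATEST K. \<forall>f. \<forall>x\<in>V. carre2 adj f x \<ge> K * carre adj f f x)"

definition slice_verts :: "nat \<Rightarrow> (nat \<Rightarrow> int) set" where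
  "slice_verts n = {x \<in> {1..2 * n} \<rightarrow>\<^sub>E {- 1, 1}. (\<Sum>i = 1..2 * n. x i) = 0}"

definition slice_adj :: "nat \<Rightarrow> (nat \<Rightarrow> int) \<Rightarrow> (nat \<Rightarrow> int) \<Rightarrow> bool" where
  "slice_adj n x y \<longleftrightarrow> x \<in> slice_verts n \<and> y \<in> slice_verts n \<and>
     (\<exists>i. {j \<in> {1..2 * n}. x j - y j \<noteq> 0} = {i, i + 1})"

lemma slice_vertsD:
  assumes "x \<in> slice_verts n"
  shows "j \<in> {1..2 * n} \<Longrightarrow> x j = - 1 \<or> x j = 1"
    and "j \<notin> {1..2 * n} \<Longrightarrow> x j = undefined"
    and "(\<Sum>i = 1..2 * n. x i) = 0"
  using assms unfolding slice_verts_def by (auto simp: PiE_iff extensional_def)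

lemma sum_split_pair:
  fixes x :: "nat \<Rightarrow> int"
  assumes "i \<in> {1..2 * n}" "i + 1 \<in> {1..2 * n}"
  shows "(\<Sum>j = 1..2 * n. x j) = x i + x (i + 1) + (\<Sum>j \<in> {1..2 * n} - {i, i + 1}. x j)"
proof -
  have "(\<Sum>j = 1..2 * n. x j) = (\<Sum>j \<in> {i, i + 1}. x j) + (\<Sum>j \<in> {1..2 * n} - {i, i + 1}. x j)"
    using assms by (subst sum.subset_diff[of "{i, i + 1}"]) auto
  then show ?thesis by simp
qed

lemma slice_adj_iff_transpose:
  "slice_adj n x y \<longleftrightarrow> x \<in> slice_verts n \<and>
     (\<exists>i. i \<in> {1..2 * n} \<and> i + 1 \<in> {1..2 * n} \<and> x i \<noteq> x (i + 1) \<and>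
          y = x(i := x (i + 1), i + 1 := x i))" (is "?L \<longleftrightarrow> ?R")
proof
  assume ?L
  then obtain i where x: "x \<in> slice_verts n" and y: "y \<in> slice_verts n"
    and eq: "{j \<in> {1..2 * n}. x j - y j \<noteq> 0} = {i, i + 1}"
    unfolding slice_adj_def by blast
  have i: "i \<in> {1..2 * n}" "i + 1 \<in> {1..2 * n}" and ne: "x i \<noteq> y i" "x (i + 1) \<noteq> y (i + 1)"
  proof -
    have "i \<in> {j \<in> {1..2 * n}. x j - y j \<noteq> 0}" "i + 1 \<in> {j \<in> {1..2 * n}. x j - y j \<noteq> 0}"
      unfolding eq by blast+
    then show "i \<in> {1..2 * n}" "i + 1 \<in> {1..2 * n}" "x i \<noteq> y i" "x (i + 1) \<noteq> y (i + 1)"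
      by simp_all
  qed
  have same: "x j = y j" if "j \<noteq> i" "j \<noteq> i + 1" for j
  proof (cases "j \<in> {1..2 * n}")
    case True
    have "j \<notin> {j \<in> {1..2 * n}. x j - y j \<noteq> 0}" unfolding eq using that by blast
    then show ?thesis using True by simp
  next
    case False
    then show ?thesis using slice_vertsD(2)[OF x] slice_vertsD(2)[OF y] by metis
  qed
  have "(\<Sum>j \<in> {1..2 * n} - {i, i + 1}. x j) = (\<Sum>j \<in> {1..2 * n} - {i, i + 1}. y j)"
    using same by (intro sum.cong) auto
  then have "x i + x (i + 1) = y i + y (i + 1)"
    using sum_split_pair[OF i, of x] sum_split_pair[OF i, of y]
      slice_vertsD(3)[OF x] slice_vertsD(3)[OF y] by simp
  then have sw: "x i \<noteq> x (i + 1)" "y i = x (i + 1)" "y (i + 1) = x i"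
    using slice_vertsD(1)[OF x i(1)] slice_vertsD(1)[OF x i(2)]
      slice_vertsD(1)[OF y i(1)] slice_vertsD(1)[OF y i(2)] ne by linarith+
  have "y = x(i := x (i + 1), i + 1 := x i)"
  proof
    fix j
    show "y j = (x(i := x (i + 1), i + 1 := x i)) j"
    proof (cases "j = i \<or> j = i + 1")
      case True
      then show ?thesis using sw(2,3) by (metis fun_upd_apply n_not_Suc_n Suc_eq_plus1)
    next
      case False
      then show ?thesis using same[of j] by simp
    qed
  qed
  then show ?R using x i sw(1) by blast
next
  assume ?R
  then obtain i where x: "x \<in> slice_verts n"
    and i: "i \<in> {1..2 * n}" "i + 1 \<in> {1..2 * n}" and ne: "x i \<noteq> x (i + 1)"
    and y: "y = x(i := x (i + 1), i + 1 := x i)" by blast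
  have "(\<Sum>j \<in> {1..2 * n} - {i, i + 1}. x j) = (\<Sum>j \<in> {1..2 * n} - {i, i + 1}. y j)"
    using y by (intro sum.cong) auto
  then have "(\<Sum>j = 1..2 * n. y j) = 0"
    using sum_split_pair[OF i, of x] sum_split_pair[OF i, of y] slice_vertsD(3)[OF x] y by simp
  moreover have "y \<in> {1..2 * n} \<rightarrow>\<^sub>E {- 1, 1}"
    using x i unfolding y slice_verts_def by (auto simp: PiE_iff extensional_def)
  ultimately have "y \<in> slice_verts n" unfolding slice_verts_def by blast
  moreover have "{j \<in> {1..2 * n}. x j - y j \<noteq> 0} = {i, i + 1}"
  proof (intro set_eqI)
    fix j
    show "j \<in> {j \<in> {1..2 * n}. x j - y j \<noteq> 0} \<longleftrightarrow> j \<in> {i, i + 1}"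
      using i ne by (cases "j = i"; cases "j = i + 1") (simp_all add: y)
  qed
  ultimately show ?L using x unfolding slice_adj_def by (intro conjI exI[of _ i])
qed

lemma finite_slice_verts: "finite (slice_verts n)"
proof -
  have "finite ({1..2 * n} \<rightarrow>\<^sub>E {- 1, 1 :: int})" by (rule finite_PiE) simp_all
  then show ?thesis unfolding slice_verts_def by simp
qed

lemma slice_no_isolated:
  assumes "n \<ge> 1" "x \<in> slice_verts n"
  shows "\<exists>y. slice_adj n x y"
proof (rule ccontr)
  assume no: "\<nexists>y. slice_adj n x y"
  have same: "x i = x (i + 1)" if "i \<in> {1..2 * n}" "i + 1 \<in> {1..2 * n}" for i
  proof (rule ccontr)
    assume "x i \<noteq> x (i + 1)"
    then have "slice_adj n x (x(i := x (i + 1), i + 1 := x i))"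
      unfolding slice_adj_iff_transpose using assms(2) that by (intro conjI exI[of _ i] refl)
    then show False using no by blast
  qed
  have const: "i + 1 \<le> 2 * n \<Longrightarrow> x (i + 1) = x 1" for i
  proof (induction i)
    case (Suc i)
    then have "x (i + 1) = x (i + 1 + 1)" by (intro same) simp_all
    then show ?case using Suc by simp
  qed simp
  have "(\<Sum>i = 1..2 * n. x i) = (\<Sum>i = 1..2 * n. x 1)"
  proof (rule sum.cong)
    fix i assume "i \<in> {1..2 * n}"
    then show "x i = x 1" using const[of "i - 1"] by simp
  qed simp
  then have "2 * int n * x 1 = 0"
    using slice_vertsD(3)[OF assms(2)] by simp
  then show False using slice_vertsD(1)[OF assms(2), of 1] assms(1) by auto
qed

lemma lf_graph_slice:
  assumes "n \<ge> 1"
  shows "lf_graph (slice_verts n) (slice_adj n)"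
proof
  fix x y assume "slice_adj n x y"
  then show "x \<in> slice_verts n \<and> y \<in> slice_verts n" unfolding slice_adj_def by blast
next
  fix x y assume "slice_adj n x y"
  moreover have "{j \<in> {1..2 * n}. y j - x j \<noteq> 0} = {j \<in> {1..2 * n}. x j - y j \<noteq> 0}" by auto
  ultimately show "slice_adj n y x" unfolding slice_adj_def by simp
next
  fix x show "\<not> slice_adj n x x" unfolding slice_adj_def by auto
next
  fix x
  have "{y. slice_adj n x y} \<subseteq> slice_verts n" unfolding slice_adj_def by blast
  then show "finite {y. slice_adj n x y}" using finite_slice_verts finite_subset by blast
next
  fix x assume "x \<in> slice_verts n"
  then show "\<exists>y. slice_adj n x y" using slice_no_isolated assms by blast
qed

end

theory Submission
  imports Defs "HOL-Real_Asymp.Real_Asymp"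
begin

text \<open>
  Fix a vertex \<open>x\<close>, let \<open>S\<close> be the set of sites \<open>i\<close> with \<open>x\<^sub>i \<noteq> x\<^sub>i\<^sub>+\<^sub>1\<close>, and let \<open>g\<^sub>i\<close> be the increment of
  \<open>f\<close> along the swap at \<open>i \<in> S\<close>. Minimising \<open>2 \<Gamma>\<^sub>2(f)(x)\<close> over the values of \<open>f\<close> at distance two,
  swaps at non-adjacent sites commute and contribute \<open>(g\<^sub>i - g\<^sub>j)\<^sup>2\<close>, while a swap at a site adjacent
  to \<open>i\<close> that only opens up after the swap at \<open>i\<close> leads to a vertex with a unique midpoint.
  The minimum is
  \<open>\<Sum>\<^sub>i g\<^sub>i\<^sup>2 (2 + (d(x) - d(y\<^sub>i)) / 2) - \<Sum> (g\<^sub>i - g\<^sub>i\<^sub>+\<^sub>1)\<^sup>2\<close>, where \<open>d\<close> is the degree, \<open>y\<^sub>i\<close> the neighbour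
  reached by the swap at \<open>i\<close>, and the last sum is over \<open>i, i + 1 \<in> S\<close>.
  Bounding \<open>(g\<^sub>i - g\<^sub>i\<^sub>+\<^sub>1)\<^sup>2 \<le> 2 g\<^sub>i\<^sup>2 + 2 g\<^sub>i\<^sub>+\<^sub>1\<^sup>2\<close> gives the curvature bound \<open>-1\<close>.
  It is asymptotically sharp at the alternating vertex for \<open>g\<^sub>i = \<plusminus>(- 1)\<^sup>i\<close>, which up to scaling is realised by
  the linear function \<open>f(z) = \<Sum>\<^sub>k k z\<^sub>k\<close>.
\<close>

section \<open>Swaps of adjacent entries and the neighbourhoods they generate\<close>

definition adj_swap :: "(nat \<Rightarrow> int) \<Rightarrow> nat \<Rightarrow> nat \<Rightarrow> int" where
  "adj_swap x i = x(i := x (i + 1), i + 1 := x i)"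

definition swap_sites :: "nat \<Rightarrow> (nat \<Rightarrow> int) \<Rightarrow> nat set" where
  "swap_sites n x = {i \<in> {1..<2 * n}. x i \<noteq> x (i + 1)}"

text \<open>The sites other than \<open>i\<close> whose pair overlaps \<open>{i, i + 1}\<close>.
  Writing both cases with addition keeps the relation visibly symmetric and avoids truncated
  subtraction.\<close>

definition near :: "nat \<Rightarrow> nat set" where
  "near i = {j. j = i + 1 \<or> i = j + 1}"

lemma near_subset: "near i \<subseteq> {i - 1, i + 1}"
  by (auto simp: near_def)

lemma finite_near [simp]: "finite (near i)"
  by (rule finite_subset[OF near_subset]) simp

lemma card_near_le: "card (near i) \<le> 2"
proof -
  have "card (near i) \<le> card {i - 1, i + 1}" by (rule card_mono[OF _ near_subset]) simp
  also have "\<dots> \<le> 2" by (simp add: card_insert_if)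
  finally show ?thesis .
qed

lemma finite_swap_sites [simp]: "finite (swap_sites n x)"
  by (simp add: swap_sites_def)

lemma adj_swap_twice [simp]: "adj_swap (adj_swap x i) i = x"
  by (auto simp: adj_swap_def)

text \<open>Either \<open>i = j\<close>, which is trivial, or the two transposed pairs are
  disjoint.\<close>

lemma adj_swap_commute:
  assumes "j \<notin> near i"
  shows "adj_swap (adj_swap x i) j = adj_swap (adj_swap x j) i"
  using assms by (cases "i = j") (auto simp: adj_swap_def near_def fun_eq_iff)

lemma slice_neighbours:
  assumes "x \<in> slice_verts n"
  shows "{y. slice_adj n x y} = adj_swap x ` swap_sites n x"
  using assms unfolding slice_adj_iff_transpose swap_sites_def adj_swap_def by (auto simp: image_iff)

text \<open>The set of positions changed by the swap is exactly \<open>{i, i + 1}\<close>, which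
  determines \<open>i\<close>.\<close>

lemma inj_on_adj_swap: "inj_on (adj_swap x) (swap_sites n x)"
proof (rule inj_onI)
  fix i j assume "i \<in> swap_sites n x" "j \<in> swap_sites n x" and eq: "adj_swap x i = adj_swap x j"
  moreover have "{k. adj_swap x i k \<noteq> x k} = {i, i + 1}" if "i \<in> swap_sites n x" for i
  proof (rule set_eqI)
    fix k
    have "x i \<noteq> x (i + 1)" using that by (simp add: swap_sites_def)
    then show "k \<in> {k. adj_swap x i k \<noteq> x k} \<longleftrightarrow> k \<in> {i, i + 1}"
      by (cases "k = i"; cases "k = i + 1") (simp_all add: adj_swap_def)
  qed
  ultimately have "{i, i + 1} = {j, j + 1}" by metis
  then show "i = j" by (auto simp: doubleton_eq_iff)
qed

lemma adj_swap_in_slice: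
  assumes "x \<in> slice_verts n" "i \<in> swap_sites n x"
  shows "adj_swap x i \<in> slice_verts n"
proof -
  have "slice_adj n x (adj_swap x i)" using slice_neighbours[OF assms(1)] assms(2) by blast
  then show ?thesis by (simp add: slice_adj_def)
qed

lemma sum_slice_neighbours:
  assumes "x \<in> slice_verts n"
  shows "(\<Sum>y | slice_adj n x y. F y) = (\<Sum>i\<in>swap_sites n x. F (adj_swap x i))"
  unfolding slice_neighbours[OF assms] by (simp add: sum.reindex[OF inj_on_adj_swap] o_def)

text \<open>With only two values, the swap flips the sign of both entries. A pair sharing exactly
  one entry with \<open>{i, i + 1}\<close> toggles between equal and unequal; every other pair keeps
  its status.\<close>

lemma swap_sites_adj_swap:
  assumes x: "x \<in> slice_verts n" and i: "i \<in> swap_sites n x"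
  shows "swap_sites n (adj_swap x i) =
    (swap_sites n x - near i) \<union> ((near i \<inter> {1..<2 * n}) - swap_sites n x)"
proof (rule set_eqI)
  fix j
  show "j \<in> swap_sites n (adj_swap x i) \<longleftrightarrow>
    j \<in> (swap_sites n x - near i) \<union> ((near i \<inter> {1..<2 * n}) - swap_sites n x)"
  proof (cases "j \<in> {1..<2 * n}")
    case True
    have v: "x k = - 1 \<or> x k = 1" if "k \<in> {1..2 * n}" for k using slice_vertsD(1)[OF x that] .
    have "i \<in> {1..<2 * n}" and ne: "x i \<noteq> x (i + 1)" using i by (auto simp: swap_sites_def)
    then have "x i = - 1 \<or> x i = 1" "x (i + 1) = - 1 \<or> x (i + 1) = 1"
      "x j = - 1 \<or> x j = 1" "x (j + 1) = - 1 \<or> x (j + 1) = 1"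
      using True by (auto intro!: v)
    then show ?thesis using True ne
      by (auto simp: swap_sites_def adj_swap_def near_def)
  next
    case False
    then show ?thesis by (auto simp: swap_sites_def)
  qed
qed

text \<open>If \<open>a\<close> of the at most two sites near \<open>i\<close> are open, the swap
  closes these and opens at most \<open>2 - a\<close>, so the degree grows by at most
  \<open>2 - 2 * a\<close>.\<close>

lemma card_swap_sites_adj_swap:
  assumes x: "x \<in> slice_verts n" and i: "i \<in> swap_sites n x"
  shows "card (swap_sites n (adj_swap x i)) + 2 * card (swap_sites n x \<inter> near i)
    \<le> card (swap_sites n x) + 2"
proof -
  let ?S = "swap_sites n x" and ?N = "near i"
  have "card (swap_sites n (adj_swap x i)) \<le> card (?S - ?N) + card (?N - ?S)"
    unfolding swap_sites_adj_swap[OF assms]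
    by (rule order_trans[OF card_Un_le add_mono[OF order_refl card_mono]]) auto
  moreover have "card ?S = card (?S \<inter> ?N) + card (?S - ?N)"
    by (metis card_Int_Diff finite_swap_sites)
  moreover have "card ?N = card (?S \<inter> ?N) + card (?N - ?S)"
    by (metis card_Int_Diff finite_near Int_commute)
  ultimately show ?thesis using card_near_le[of i] by linarith
qed

section \<open>The operators \<Gamma> and \<Gamma>_2 in terms of increments along swaps\<close>

lemma carre_slice:
  assumes "x \<in> slice_verts n"
  shows "carre (slice_adj n) f f x = 1 / 2 * (\<Sum>i\<in>swap_sites n x. (f (adj_swap x i) - f x)\<^sup>2)"
  unfolding carre_def sum_slice_neighbours[OF assms] by (simp add: power2_eq_square algebra_simps)

text \<open>Completing the square in \<open>h i j\<close> makes the values after two swaps enter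
  only through squares. The term \<open>(\<Sum>i\<in>S. g i)\<^sup>2\<close> is the contribution of
  the Laplacian at \<open>x\<close> itself to \<Gamma>(f, \<Delta>f).\<close>

lemma carre2_slice:
  fixes f :: "(nat \<Rightarrow> int) \<Rightarrow> real"
  assumes x: "x \<in> slice_verts n"
  defines "S \<equiv> swap_sites n x" and "y \<equiv> adj_swap x"
  defines "g \<equiv> \<lambda>i. f (y i) - f x" and "h \<equiv> \<lambda>i j. f (adj_swap (y i) j) - f x"
  shows "2 * carre2 (slice_adj n) f x =
    (\<Sum>i\<in>S. g i)\<^sup>2 - card S / 2 * (\<Sum>i\<in>S. (g i)\<^sup>2) +
    (\<Sum>i\<in>S. (\<Sum>j\<in>swap_sites n (y i). (h i j - 2 * g i)\<^sup>2 / 2) - card (swap_sites n (y i)) / 2 * (g i)\<^sup>2)"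
proof -
  let ?G = "\<Sum>i\<in>S. g i" and ?Q = "\<Sum>i\<in>S. (g i)\<^sup>2"
  have y: "y i \<in> slice_verts n" if "i \<in> S" for i
    using adj_swap_in_slice[OF x] that by (simp add: S_def y_def)
  have carre_y: "carre (slice_adj n) f f (y i) = 1 / 2 * (\<Sum>j\<in>swap_sites n (y i). (h i j - g i)\<^sup>2)"
    if "i \<in> S" for i
    unfolding carre_slice[OF y[OF that]] by (simp add: g_def h_def)
  have carre_x: "carre (slice_adj n) f f x = 1 / 2 * ?Q"
    unfolding carre_slice[OF x] by (simp add: g_def y_def S_def)
  have lap_y: "laplacian (slice_adj n) f (y i) = (\<Sum>j\<in>swap_sites n (y i). h i j - g i)" if "i \<in> S" for i
    unfolding laplacian_def sum_slice_neighbours[OF y[OF that]] by (simp add: g_def h_def)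
  have lap_x: "laplacian (slice_adj n) f x = ?G"
    unfolding laplacian_def sum_slice_neighbours[OF x] by (simp add: g_def y_def S_def)
  have "laplacian (slice_adj n) (carre (slice_adj n) f f) x =
    (\<Sum>i\<in>S. 1 / 2 * (\<Sum>j\<in>swap_sites n (y i). (h i j - g i)\<^sup>2) - 1 / 2 * ?Q)"
    unfolding laplacian_def[of _ "carre (slice_adj n) f f"] sum_slice_neighbours[OF x]
    by (fold S_def y_def) (simp add: carre_y carre_x)
  also have "\<dots> = (\<Sum>i\<in>S. 1 / 2 * (\<Sum>j\<in>swap_sites n (y i). (h i j - g i)\<^sup>2)) - card S / 2 * ?Q"
    by (simp add: sum_subtractf)
  finally have 1: "laplacian (slice_adj n) (carre (slice_adj n) f f) x = \<dots>" .
  have "2 * carre (slice_adj n) f (laplacian (slice_adj n) f) x =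
    (\<Sum>i\<in>S. g i * (laplacian (slice_adj n) f (y i) - ?G))"
    unfolding carre_def sum_slice_neighbours[OF x] lap_x
    by (fold S_def y_def) (simp add: g_def algebra_simps)
  also have "\<dots> = (\<Sum>i\<in>S. g i * (\<Sum>j\<in>swap_sites n (y i). h i j - g i)) - ?G\<^sup>2"
    by (simp add: lap_y right_diff_distrib sum_subtractf power2_eq_square flip: sum_distrib_right)
  finally have 2: "2 * carre (slice_adj n) f (laplacian (slice_adj n) f) x = \<dots>" .
  have "1 / 2 * (\<Sum>j\<in>T. (h i j - g i)\<^sup>2) - g i * (\<Sum>j\<in>T. h i j - g i) =
    (\<Sum>j\<in>T. (h i j - 2 * g i)\<^sup>2 / 2) - card T / 2 * (g i)\<^sup>2" for i and T :: "nat set"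
  proof -
    have "1 / 2 * (\<Sum>j\<in>T. (h i j - g i)\<^sup>2) - g i * (\<Sum>j\<in>T. h i j - g i) =
      (\<Sum>j\<in>T. 1 / 2 * (h i j - g i)\<^sup>2 - g i * (h i j - g i))"
      using sum_subtractf[of "\<lambda>j. 1 / 2 * (h i j - g i)\<^sup>2" "\<lambda>j. g i * (h i j - g i)" T]
      by (simp only: sum_distrib_left)
    also have "\<dots> = (\<Sum>j\<in>T. (h i j - 2 * g i)\<^sup>2 / 2 - (g i)\<^sup>2 / 2)"
      by (rule sum.cong) (auto simp: power2_eq_square algebra_simps)
    also have "\<dots> = (\<Sum>j\<in>T. (h i j - 2 * g i)\<^sup>2 / 2) - card T / 2 * (g i)\<^sup>2"
      by (simp add: sum_subtractf)
    finally show ?thesis .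
  qed
  then have "(\<Sum>i\<in>S. 1 / 2 * (\<Sum>j\<in>swap_sites n (y i). (h i j - g i)\<^sup>2)) -
      (\<Sum>i\<in>S. g i * (\<Sum>j\<in>swap_sites n (y i). h i j - g i)) =
    (\<Sum>i\<in>S. (\<Sum>j\<in>swap_sites n (y i). (h i j - 2 * g i)\<^sup>2 / 2) - card (swap_sites n (y i)) / 2 * (g i)\<^sup>2)"
    unfolding sum_subtractf[symmetric] by simp
  moreover have "2 * carre2 (slice_adj n) f x =
    laplacian (slice_adj n) (carre (slice_adj n) f f) x - 2 * carre (slice_adj n) f (laplacian (slice_adj n) f) x"
    unfolding carre2_def by simp
  ultimately show ?thesis using 1 2 by linarith
qed

section \<open>The lower curvature bound\<close>

text \<open>Lagrange's identity for \<open>g\<close> and the constant 1. It turns the squared sum in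
  the \<Gamma>_2 formula into pairwise differences, which can be compared with commuting squares one
  pair at a time.\<close>

lemma sum_pairs_diff_square:
  fixes g :: "'b \<Rightarrow> real"
  shows "(\<Sum>i\<in>S. \<Sum>j\<in>S. (g i - g j)\<^sup>2 / 2) = card S * (\<Sum>i\<in>S. (g i)\<^sup>2) - (\<Sum>i\<in>S. g i)\<^sup>2"
proof -
  have "(\<Sum>i\<in>S. \<Sum>j\<in>S. (g i - g j)\<^sup>2 / 2) = (\<Sum>i\<in>S. \<Sum>j\<in>S. (g i)\<^sup>2 / 2 + (g j)\<^sup>2 / 2 - g i * g j)"
    by (intro sum.cong refl) (simp add: power2_eq_square field_simps)
  also have "\<dots> = card S * (\<Sum>i\<in>S. (g i)\<^sup>2) - (\<Sum>i\<in>S. g i)\<^sup>2"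
    by (simp add: sum.distrib sum_subtractf power2_eq_square sum_product flip: sum_distrib_left sum_divide_distrib)
  finally show ?thesis .
qed

lemma curvature_ge_minus_one:
  assumes x: "x \<in> slice_verts n"
  shows "carre2 (slice_adj n) f x \<ge> - 1 * carre (slice_adj n) f f x"
proof -
  define S where "S = swap_sites n x"
  define y where "y = adj_swap x"
  define g where "g i = f (y i) - f x" for i
  define h where "h i j = f (adj_swap (y i) j) - f x" for i j
  define T where "T i = swap_sites n (y i)" for i
  \<comment> \<open>Open sites other than \<open>i\<close> whose swap commutes with the one at
    \<open>i\<close>; they stay open after it.\<close>
  define far where "far i = S - near i - {i}" for i
  define a where "a i = card (S \<inter> near i)" for i
  have fin: "finite S" "finite (T i)" "finite (far i)" for i by (auto simp: S_def T_def far_def)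
  have T: "T i = (S - near i) \<union> ((near i \<inter> {1..<2 * n}) - S)" if "i \<in> S" for i
    using swap_sites_adj_swap[OF x] that by (simp add: T_def S_def y_def)
  have far_sym: "(\<Sum>i\<in>S. \<Sum>j\<in>far i. F i j) = (\<Sum>i\<in>S. \<Sum>j\<in>far i. F j i)" for F :: "nat \<Rightarrow> nat \<Rightarrow> real"
  proof -
    have "(\<Sum>i\<in>S. \<Sum>j\<in>far i. F i j) = (\<Sum>i\<in>S. \<Sum>j | j \<in> S \<and> j \<notin> near i \<and> j \<noteq> i. F i j)"
      by (intro sum.cong) (auto simp: far_def)
    also have "\<dots> = (\<Sum>j\<in>S. \<Sum>i | i \<in> S \<and> j \<notin> near i \<and> j \<noteq> i. F i j)"
      by (rule sum.swap_restrict) (use fin in auto)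
    also have "\<dots> = (\<Sum>i\<in>S. \<Sum>j\<in>far i. F j i)"
      by (intro sum.cong) (auto simp: far_def near_def)
    finally show ?thesis .
  qed
  have near_sym_sum: "(\<Sum>i\<in>S. \<Sum>j\<in>S \<inter> near i. F i j) = (\<Sum>i\<in>S. \<Sum>j\<in>S \<inter> near i. F j i)" for F :: "nat \<Rightarrow> nat \<Rightarrow> real"
  proof -
    have "(\<Sum>i\<in>S. \<Sum>j\<in>S \<inter> near i. F i j) = (\<Sum>i\<in>S. \<Sum>j | j \<in> S \<and> j \<in> near i. F i j)"
      by (intro sum.cong) auto
    also have "\<dots> = (\<Sum>j\<in>S. \<Sum>i | i \<in> S \<and> j \<in> near i. F i j)"
      by (rule sum.swap_restrict) (use fin in auto)
    also have "\<dots> = (\<Sum>i\<in>S. \<Sum>j\<in>S \<inter> near i. F j i)"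
      by (intro sum.cong) (auto simp: near_def)
    finally show ?thesis .
  qed
  \<comment> \<open>The two paths around a commuting square share the endpoint value \<open>h i j\<close>, whose optimum is \<open>g i + g j\<close>.\<close>
  have square: "(\<Sum>i\<in>S. \<Sum>j\<in>far i. (g i - g j)\<^sup>2 / 2) \<le> (\<Sum>i\<in>S. \<Sum>j\<in>far i. (h i j - 2 * g i)\<^sup>2 / 2)"
  proof -
    \<comment> \<open>Only the sum of the \<open>(i, j)\<close> and \<open>(j, i)\<close> terms is
      bounded below, so the doubled inequality comes first and \<open>far_sym\<close> merges the two
      halves.\<close>
    have "(\<Sum>i\<in>S. \<Sum>j\<in>far i. (g i - g j)\<^sup>2) \<le>
      (\<Sum>i\<in>S. \<Sum>j\<in>far i. (h i j - 2 * g i)\<^sup>2 / 2 + (h j i - 2 * g j)\<^sup>2 / 2)"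
    proof (intro sum_mono)
      fix i j assume "j \<in> far i"
      then have h: "h j i = h i j"
        using adj_swap_commute[of j i x] by (auto simp: h_def y_def far_def)
      have "(h i j - 2 * g i)\<^sup>2 / 2 + (h i j - 2 * g j)\<^sup>2 / 2 - (g i - g j)\<^sup>2 = (h i j - g i - g j)\<^sup>2"
        by (simp add: power2_eq_square field_simps)
      moreover have "0 \<le> (h i j - g i - g j)\<^sup>2" by simp
      ultimately show "(g i - g j)\<^sup>2 \<le> (h i j - 2 * g i)\<^sup>2 / 2 + (h j i - 2 * g j)\<^sup>2 / 2"
        unfolding h by linarith
    qed
    also have "\<dots> = 2 * (\<Sum>i\<in>S. \<Sum>j\<in>far i. (h i j - 2 * g i)\<^sup>2 / 2)"
      using far_sym[of "\<lambda>i j. (h i j - 2 * g i)\<^sup>2 / 2"] by (simp add: sum.distrib)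
    finally show ?thesis by (simp flip: sum_divide_distrib)
  qed
  \<comment> \<open>The loss \<open>(g i + g j)\<^sup>2 / 2\<close> vanishes exactly when
    \<open>g j = - g i\<close>, which is why increments of alternating sign are extremal.\<close>
  have near_bound: "(\<Sum>i\<in>S. \<Sum>j\<in>S \<inter> near i. (g i - g j)\<^sup>2 / 2) \<le> (\<Sum>i\<in>S. 2 * a i * (g i)\<^sup>2)"
  proof -
    have "(\<Sum>i\<in>S. \<Sum>j\<in>S \<inter> near i. (g i - g j)\<^sup>2 / 2) \<le> (\<Sum>i\<in>S. \<Sum>j\<in>S \<inter> near i. (g i)\<^sup>2 + (g j)\<^sup>2)"
    proof (intro sum_mono)
      fix i j
      have "(g i)\<^sup>2 + (g j)\<^sup>2 - (g i - g j)\<^sup>2 / 2 = (g i + g j)\<^sup>2 / 2"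
        by (simp add: power2_eq_square field_simps)
      moreover have "0 \<le> (g i + g j)\<^sup>2 / 2" by simp
      ultimately show "(g i - g j)\<^sup>2 / 2 \<le> (g i)\<^sup>2 + (g j)\<^sup>2" by linarith
    qed
    also have "\<dots> = 2 * (\<Sum>i\<in>S. \<Sum>j\<in>S \<inter> near i. (g i)\<^sup>2)"
      using near_sym_sum[of "\<lambda>i j. (g i)\<^sup>2"] by (simp add: sum.distrib)
    also have "\<dots> = (\<Sum>i\<in>S. 2 * a i * (g i)\<^sup>2)"
      by (simp add: a_def sum_distrib_left mult.assoc)
    finally show ?thesis .
  qed
  have "(\<Sum>i\<in>S. \<Sum>j\<in>S. (g i - g j)\<^sup>2 / 2) =
    (\<Sum>i\<in>S. (\<Sum>j\<in>far i. (g i - g j)\<^sup>2 / 2) + (\<Sum>j\<in>S \<inter> near i. (g i - g j)\<^sup>2 / 2))"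
  proof (rule sum.cong)
    fix i assume "i \<in> S"
    then have eq: "S = insert i (far i \<union> (S \<inter> near i))" and "i \<notin> far i \<union> (S \<inter> near i)"
      by (auto simp: far_def near_def)
    have "(\<Sum>j\<in>S. (g i - g j)\<^sup>2 / 2) = (\<Sum>j\<in>insert i (far i \<union> (S \<inter> near i)). (g i - g j)\<^sup>2 / 2)"
      by (rule arg_cong[OF eq])
    also have "\<dots> = (\<Sum>j\<in>far i \<union> (S \<inter> near i). (g i - g j)\<^sup>2 / 2)"
      using fin \<open>i \<notin> _\<close> by (subst sum.insert) auto
    also have "\<dots> = (\<Sum>j\<in>far i. (g i - g j)\<^sup>2 / 2) + (\<Sum>j\<in>S \<inter> near i. (g i - g j)\<^sup>2 / 2)"
      by (rule sum.union_disjoint) (use fin in \<open>auto simp: far_def\<close>)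
    finally show "(\<Sum>j\<in>S. (g i - g j)\<^sup>2 / 2) = \<dots>" .
  qed simp
  then have pairs: "card S * (\<Sum>i\<in>S. (g i)\<^sup>2) - (\<Sum>i\<in>S. g i)\<^sup>2 =
    (\<Sum>i\<in>S. \<Sum>j\<in>far i. (g i - g j)\<^sup>2 / 2) + (\<Sum>i\<in>S. \<Sum>j\<in>S \<inter> near i. (g i - g j)\<^sup>2 / 2)"
    unfolding sum_pairs_diff_square by (simp add: sum.distrib)
  \<comment> \<open>Swapping twice at \<open>i\<close> returns to \<open>x\<close>, which yields
    \<open>2 * (g i)\<^sup>2\<close>. The sites of \<open>T i\<close> that open up near
    \<open>i\<close> give nonnegative terms, which are dropped.\<close>
  have inner: "2 * (g i)\<^sup>2 + (\<Sum>j\<in>far i. (h i j - 2 * g i)\<^sup>2 / 2) \<le> (\<Sum>j\<in>T i. (h i j - 2 * g i)\<^sup>2 / 2)"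
    if "i \<in> S" for i
  proof -
    have "h i i = 0" by (simp add: h_def y_def)
    then have "2 * (g i)\<^sup>2 + (\<Sum>j\<in>far i. (h i j - 2 * g i)\<^sup>2 / 2) =
      (\<Sum>j\<in>insert i (far i). (h i j - 2 * g i)\<^sup>2 / 2)"
      using fin by (subst sum.insert) (auto simp: far_def power2_eq_square)
    also have "\<dots> \<le> (\<Sum>j\<in>T i. (h i j - 2 * g i)\<^sup>2 / 2)"
      by (rule sum_mono2) (use fin that in \<open>auto simp: T far_def near_def\<close>)
    finally show ?thesis .
  qed
  \<comment> \<open>The degree estimate gives
    \<open>2 + (card S - card (T i)) / 2 - 2 * a i \<ge> 1 - a i\<close>, and
    \<open>a i \<le> 2\<close>.\<close>
  have coeff: "- (g i)\<^sup>2 \<le> 2 * (g i)\<^sup>2 + card S / 2 * (g i)\<^sup>2 - card (T i) / 2 * (g i)\<^sup>2 - 2 * a i * (g i)\<^sup>2"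
    if "i \<in> S" for i
  proof -
    have "card (T i) + 2 * a i \<le> card S + 2"
      using card_swap_sites_adj_swap[OF x] that by (simp add: T_def a_def S_def y_def)
    moreover have "a i \<le> 2"
      unfolding a_def by (rule order_trans[OF card_mono card_near_le]) auto
    ultimately have "real (card (T i)) + 2 * real (a i) \<le> real (card S) + 2" "real (a i) \<le> 2"
      by linarith+
    then have "- 1 \<le> 2 + card S / 2 - card (T i) / 2 - 2 * real (a i)" by linarith
    from mult_right_mono[OF this zero_le_power2[of "g i"]] show ?thesis
      by (simp add: algebra_simps)
  qed
  have "2 * carre2 (slice_adj n) f x =
    (\<Sum>i\<in>S. g i)\<^sup>2 - card S / 2 * (\<Sum>i\<in>S. (g i)\<^sup>2) +
    ((\<Sum>i\<in>S. \<Sum>j\<in>T i. (h i j - 2 * g i)\<^sup>2 / 2) - (\<Sum>i\<in>S. card (T i) / 2 * (g i)\<^sup>2))"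
    using carre2_slice[OF x, of f] by (simp add: S_def y_def g_def h_def T_def sum_subtractf)
  moreover have "(\<Sum>i\<in>S. 2 * (g i)\<^sup>2) + (\<Sum>i\<in>S. \<Sum>j\<in>far i. (h i j - 2 * g i)\<^sup>2 / 2) \<le>
      (\<Sum>i\<in>S. \<Sum>j\<in>T i. (h i j - 2 * g i)\<^sup>2 / 2)"
    unfolding sum.distrib[symmetric] by (rule sum_mono) (rule inner)
  moreover have "- (\<Sum>i\<in>S. (g i)\<^sup>2) \<le> (\<Sum>i\<in>S. 2 * (g i)\<^sup>2) + card S / 2 * (\<Sum>i\<in>S. (g i)\<^sup>2)
      - (\<Sum>i\<in>S. card (T i) / 2 * (g i)\<^sup>2) - (\<Sum>i\<in>S. 2 * a i * (g i)\<^sup>2)"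
    unfolding sum_distrib_left[of "card S / 2"] sum.distrib[symmetric] sum_subtractf[symmetric] sum_negf[symmetric]
    by (rule sum_mono) (rule coeff)
  \<comment> \<open>By \<open>pairs\<close>, the first two terms of the formula equal
    \<open>card S / 2 * (\<Sum>i\<in>S. (g i)\<^sup>2)\<close> minus the far and near differences.
    The far ones are absorbed by \<open>square\<close>, the near ones are controlled by
    \<open>near_bound\<close>.\<close>
  ultimately have "2 * carre2 (slice_adj n) f x \<ge> - (\<Sum>i\<in>S. (g i)\<^sup>2)"
    using square near_bound pairs by simp
  moreover have "carre (slice_adj n) f f x = 1 / 2 * (\<Sum>i\<in>S. (g i)\<^sup>2)"
    unfolding carre_slice[OF x] by (simp add: g_def y_def S_def)
  ultimately show ?thesis by simp
qed

section \<open>The curvature as an attained maximum\<close>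

text \<open>\<open>GREATEST\<close> is informative only if a maximum exists. The admissible
  constants form a nonempty set, closed as an intersection of closed conditions and bounded above
  through \<open>f0\<close> at \<open>x0\<close>, so the set contains its supremum.\<close>

lemma Ric_bounds:
  assumes lower: "\<And>f x. x \<in> V \<Longrightarrow> K * carre adj f f x \<le> carre2 adj f x"
    and x0: "x0 \<in> V" and pos: "carre adj f0 f0 x0 > 0"
  shows "K \<le> Ric V adj" and "Ric V adj * carre adj f0 f0 x0 \<le> carre2 adj f0 x0"
proof -
  define A where "A = {K. \<forall>f. \<forall>x\<in>V. carre2 adj f x \<ge> K * carre adj f f x}"
  have bdd: "bdd_above A"
    by (rule bdd_aboveI[of _ "carre2 adj f0 x0 / carre adj f0 f0 x0"])
      (use x0 pos in \<open>auto simp: A_def field_simps\<close>)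
  have ne: "K \<in> A" using lower by (auto simp: A_def)
  have "A = (\<Inter>f. \<Inter>x\<in>V. {K. K * carre adj f f x \<le> carre2 adj f x})"
    by (auto simp: A_def)
  then have "closed A"
    by (auto intro!: closed_INT closed_Collect_le continuous_intros)
  then have "Sup A \<in> A" using closed_contains_Sup bdd ne by blast
  moreover have "Ric V adj = Sup A"
    unfolding Ric_def
    by (rule Greatest_equality) (use \<open>Sup A \<in> A\<close> bdd in \<open>auto simp: A_def intro: cSup_upper\<close>)
  ultimately show "K \<le> Ric V adj" "Ric V adj * carre adj f0 f0 x0 \<le> carre2 adj f0 x0"
    using ne bdd x0 by (auto simp: A_def intro: cSup_upper)
qed

section \<open>The linear test function at the alternating vertex\<close>

text \<open>The extremal test function: on the slice, every swap at an open site changes it by 2 or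
  -2.\<close>

definition moment :: "nat \<Rightarrow> (nat \<Rightarrow> int) \<Rightarrow> real" where
  "moment n z = (\<Sum>k = 1..2 * n. real k * z k)"

lemma moment_adj_swap:
  assumes "i \<in> {1..<2 * n}"
  shows "moment n (adj_swap z i) - moment n z = z i - z (i + 1)"
proof -
  have split: "moment n w = real i * w i + real (i + 1) * w (i + 1) +
      (\<Sum>k\<in>{1..2 * n} - {i, i + 1}. real k * w k)" for w
    unfolding moment_def using assms by (subst sum.subset_diff[of "{i, i + 1}"]) auto
  have "(\<Sum>k\<in>{1..2 * n} - {i, i + 1}. real k * adj_swap z i k) =
    (\<Sum>k\<in>{1..2 * n} - {i, i + 1}. real k * z k)"
    by (rule sum.cong) (auto simp: adj_swap_def)
  then show ?thesis unfolding split by (simp add: adj_swap_def algebra_simps)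
qed

lemma moment_step_square:
  assumes "z \<in> slice_verts n" "i \<in> swap_sites n z"
  shows "(real_of_int (z i) - z (i + 1))\<^sup>2 = 4"
proof -
  have "z i = - 1 \<or> z i = 1" "z (i + 1) = - 1 \<or> z (i + 1) = 1" "z i \<noteq> z (i + 1)"
    using assms slice_vertsD(1)[OF assms(1)] by (auto simp: swap_sites_def)
  then show ?thesis by auto
qed

lemma carre_moment:
  assumes "z \<in> slice_verts n"
  shows "carre (slice_adj n) (moment n) (moment n) z = 2 * card (swap_sites n z)"
proof -
  have "(\<Sum>i\<in>swap_sites n z. (moment n (adj_swap z i) - moment n z)\<^sup>2) = (\<Sum>i\<in>swap_sites n z. 4)"
  proof (rule sum.cong)
    fix i assume i: "i \<in> swap_sites n z"
    then have "i \<in> {1..<2 * n}" by (simp add: swap_sites_def)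
    then show "(moment n (adj_swap z i) - moment n z)\<^sup>2 = 4"
      using moment_step_square[OF assms i] by (simp add: moment_adj_swap)
  qed simp
  then show ?thesis unfolding carre_slice[OF assms] by simp
qed

text \<open>Closed sites contribute zero, so the sum extends to all sites and telescopes. Hence only
  swaps touching an end entry can change this Laplacian.\<close>

lemma laplacian_moment:
  assumes "z \<in> slice_verts n" "n \<ge> 1"
  shows "laplacian (slice_adj n) (moment n) z = z 1 - z (2 * n)"
proof -
  have "laplacian (slice_adj n) (moment n) z = (\<Sum>i\<in>swap_sites n z. real_of_int (z i) - z (i + 1))"
    unfolding laplacian_def sum_slice_neighbours[OF assms(1)]
    by (rule sum.cong) (auto simp: swap_sites_def moment_adj_swap)
  also have "\<dots> = (\<Sum>i\<in>{1..<2 * n}. real_of_int (z i) - z (i + 1))"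
    by (rule sum.mono_neutral_left) (auto simp: swap_sites_def)
  also have "\<dots> = z 1 - z (2 * n)"
    using sum_Suc_diff'[of 1 "2 * n" "\<lambda>i. - real_of_int (z i)"] assms(2) by simp
  finally show ?thesis .
qed

text \<open>The vertex where every site is open. The restriction supplies the value
  \<open>undefined\<close> off the index range that \<open>slice_verts\<close> demands.\<close>

definition alternating :: "nat \<Rightarrow> nat \<Rightarrow> int" where
  "alternating n = restrict (\<lambda>i. (- 1) ^ i) {1..2 * n}"

lemma alternating_in_slice: "alternating n \<in> slice_verts n"
proof -
  have "(\<Sum>i = 1..2 * n. alternating n i) = (\<Sum>i = 1..2 * n. (- 1) ^ i)"
    by (rule sum.cong) (auto simp: alternating_def)
  also have "\<dots> = 0" by (induction n) auto
  finally show ?thesis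
    unfolding slice_verts_def by (auto simp: alternating_def minus_one_power_iff)
qed

lemma swap_sites_alternating: "swap_sites n (alternating n) = {1..<2 * n}"
  by (auto simp: swap_sites_def alternating_def)

text \<open>An interior swap closes two sites, opens none and keeps both end entries, so it
  contributes -2. The sites \<open>1\<close> and \<open>2 * n - 1\<close>, distinct for
  \<open>n \<ge> 2\<close>, contribute at most 2 each; these two corrections of 4 make up the
  8.\<close>

lemma carre2_moment_alternating:
  assumes n: "n \<ge> 2"
  shows "carre2 (slice_adj n) (moment n) (alternating n) \<le> 8 - 2 * (2 * real n - 1)"
proof -
  let ?x = "alternating n"
  let ?S = "{1..<2 * n}"
  let ?L = "laplacian (slice_adj n) (moment n)"
  note x = alternating_in_slice[of n]
  have y: "adj_swap ?x i \<in> slice_verts n" if "i \<in> ?S" for i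
    using adj_swap_in_slice[OF x] that swap_sites_alternating by blast
  have lap: "laplacian (slice_adj n) (carre (slice_adj n) (moment n) (moment n)) ?x =
    (\<Sum>i\<in>?S. 2 * (real (card (swap_sites n (adj_swap ?x i))) - card ?S))"
    unfolding laplacian_def sum_slice_neighbours[OF x] swap_sites_alternating
    by (rule sum.cong) (auto simp: carre_moment x y swap_sites_alternating)
  have car: "carre (slice_adj n) (moment n) ?L ?x =
    1 / 2 * (\<Sum>i\<in>?S. (moment n ?x - moment n (adj_swap ?x i)) * (?L ?x - ?L (adj_swap ?x i)))"
    unfolding carre_def sum_slice_neighbours[OF x] swap_sites_alternating ..
  have "carre2 (slice_adj n) (moment n) ?x =
    (\<Sum>i\<in>?S. real (card (swap_sites n (adj_swap ?x i))) - card ?S -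
      1 / 2 * ((moment n ?x - moment n (adj_swap ?x i)) * (?L ?x - ?L (adj_swap ?x i))))"
    unfolding carre2_def lap car sum_distrib_left sum_subtractf[symmetric]
    by (rule sum.cong) (auto simp: field_simps)
  also have "\<dots> \<le> (\<Sum>i\<in>?S. - 2 + ((if i = 1 then 4 else 0) + (if i = 2 * n - 1 then 4 else 0)))"
  proof (rule sum_mono)
    fix i assume i: "i \<in> ?S"
    have m: "moment n ?x - moment n (adj_swap ?x i) = real_of_int (?x (i + 1)) - ?x i"
      using moment_adj_swap[OF i, of ?x] by simp
    have L: "?L ?x - ?L (adj_swap ?x i) =
      real_of_int (?x 1) - ?x (2 * n) - (adj_swap ?x i 1 - adj_swap ?x i (2 * n))"
      using laplacian_moment x y[OF i] n by simp
    have T: "swap_sites n (adj_swap ?x i) = ?S - near i"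
      using swap_sites_adj_swap[OF x] i by (auto simp: swap_sites_alternating)
    have sq: "(real_of_int (?x i) - ?x (i + 1)) * (real_of_int (?x i) - ?x (i + 1)) = 4"
      using moment_step_square[OF x] i by (simp add: swap_sites_alternating power2_eq_square)
    show "real (card (swap_sites n (adj_swap ?x i))) - card ?S -
      1 / 2 * ((moment n ?x - moment n (adj_swap ?x i)) * (?L ?x - ?L (adj_swap ?x i)))
      \<le> - 2 + ((if i = 1 then 4 else 0) + (if i = 2 * n - 1 then 4 else 0))"
    proof (cases "i = 1 \<or> i = 2 * n - 1")
      case True
      have "card (swap_sites n (adj_swap ?x i)) \<le> card ?S" unfolding T by (rule card_mono) auto
      \<comment> \<open>Exactly one end entry changes, and the differences of
        \<open>moment n\<close> and of its Laplacian are opposite numbers of modulus 2.\<close>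
      moreover have "(moment n ?x - moment n (adj_swap ?x i)) * (?L ?x - ?L (adj_swap ?x i)) = - 4"
        using True sq n unfolding m L by (auto simp: adj_swap_def algebra_simps)
      ultimately show ?thesis using True by auto
    next
      case False
      have sub: "{i - 1, i + 1} \<subseteq> ?S" using i False by auto
      have "near i = {i - 1, i + 1}" using i by (auto simp: near_def)
      then have "card (swap_sites n (adj_swap ?x i)) = card ?S - 2"
        unfolding T using sub by (simp add: card_Diff_subset)
      moreover have "card ?S \<ge> 2" using n by simp
      moreover have "?L ?x - ?L (adj_swap ?x i) = 0"
        using False i unfolding L by (auto simp: adj_swap_def)
      ultimately show ?thesis using False by (simp add: of_nat_diff)
    qed
  qed
  also have "\<dots> = 8 - 2 * (2 * real n - 1)"
    unfolding sum.distrib using n by (simp add: of_nat_diff)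
  finally show ?thesis .
qed

section \<open>Two-sided bounds and the limit\<close>

lemma Ric_slice_bounds:
  assumes n: "n \<ge> 1"
  shows "- 1 \<le> Ric (slice_verts n) (slice_adj n)"
    and "n \<ge> 2 \<Longrightarrow> Ric (slice_verts n) (slice_adj n) \<le> - 1 + 4 / (2 * real n - 1)"
proof -
  let ?R = "Ric (slice_verts n) (slice_adj n)"
  have c: "carre (slice_adj n) (moment n) (moment n) (alternating n) = 2 * (2 * real n - 1)"
    using n by (simp add: carre_moment alternating_in_slice swap_sites_alternating of_nat_diff)
  have pos: "2 * (2 * real n - 1) > 0" using n by simp
  note bounds = Ric_bounds[of "slice_verts n" "- 1" "slice_adj n", OF curvature_ge_minus_one
    alternating_in_slice, where ?f0.0 = "moment n", unfolded c, OF _ pos]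
  show "- 1 \<le> ?R" using bounds(1) by simp
  assume "n \<ge> 2"
  \<comment> \<open>The factor \<open>2 * (2 * real n - 1)\<close> is \<Gamma> of
    \<open>moment n\<close> at the alternating vertex, twice the degree there; dividing by it leaves
    the error \<open>4 / (2 * real n - 1)\<close>.\<close>
  then have "?R * (2 * (2 * real n - 1)) \<le> 8 - 2 * (2 * real n - 1)"
    using bounds(2) carre2_moment_alternating by fastforce
  then show "?R \<le> - 1 + 4 / (2 * real n - 1)"
    using pos by (simp add: field_simps)
qed

theorem theorem10:
  shows "(\<forall>n\<ge>1. Ric (slice_verts n) (slice_adj n) \<ge> - 1) \<and>
         (\<lambda>n. Ric (slice_verts n) (slice_adj n)) \<longlonglongrightarrow> - 1"
proof
  show "\<forall>n\<ge>1. Ric (slice_verts n) (slice_adj n) \<ge> - 1" using Ric_slice_bounds(1) by blast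
  show "(\<lambda>n. Ric (slice_verts n) (slice_adj n)) \<longlonglongrightarrow> - 1"
  proof (rule tendsto_sandwich)
    show "\<forall>\<^sub>F n in sequentially. - 1 \<le> Ric (slice_verts n) (slice_adj n)"
      using eventually_ge_at_top[of 1] by eventually_elim (rule Ric_slice_bounds(1))
    show "\<forall>\<^sub>F n in sequentially. Ric (slice_verts n) (slice_adj n) \<le> - 1 + 4 / (2 * real n - 1)"
      using eventually_ge_at_top[of 2] by eventually_elim (rule Ric_slice_bounds(2), auto)
    show "(\<lambda>n. - 1 + 4 / (2 * real n - 1)) \<longlonglongrightarrow> - 1" by real_asymp
  qed simp
qed

end
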